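(* For every fixed positive integer $k$ there is a constant $C=C(k)>0$ such that for all integers $n\ge 2$, $$(n!)^{1/k-C/\log n}\le M_k(S_n)\le (n!)^{1/k+C/\log n},$$ i.e. $M_k(S_n)=(n!)^{1/k+O(1/\log n)}$.
   Context: For a group $\Gamma$, a set $A\subseteq\Gamma$ is an $S_k$-set if whenever $\alpha_1\cdots\alpha_k=\beta_1\cdots\beta_k$ with all $\alpha_i,\beta_i\in A$, we have $(\alpha_1,\ldots,\alpha_k)=(\beta_1,\ldots,\beta_k)$. $M_k(\Gamma)$ denotes the maximum size of an $S_k$-set in $\Gamma$. $S_n$ is the symmetric group on $n$ letters. *)

theory Defs
  imports Complex_Main "HOL-Algebra.Sym_Groups"
begin

text \<open>
  A \<open>k\<close>-tuple of group elements is a list of length \<open>k\<close>; the \<open>foldr\<close> is the product of its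
  entries in the order of the list.
\<close>

definition S_set :: "('a, 'b) monoid_scheme \<Rightarrow> nat \<Rightarrow> 'a set \<Rightarrow> bool" where
  "S_set G k A \<longleftrightarrow> A \<subseteq> carrier G \<and>
     (\<forall>as bs. length as = k \<and> length bs = k \<and> set as \<subseteq> A \<and> set bs \<subseteq> A \<and>
        foldr (\<otimes>\<^bsub>G\<^esub>) as \<one>\<^bsub>G\<^esub> = foldr (\<otimes>\<^bsub>G\<^esub>) bs \<one>\<^bsub>G\<^esub> \<longrightarrow> as = bs)"

text \<open>Only meaningful when the carrier of \<open>G\<close> is finite; see \<open>max_S_set_attained\<close>.\<close>

definition max_S_set :: "nat \<Rightarrow> ('a, 'b) monoid_scheme \<Rightarrow> nat" where
  "max_S_set k G = Max (card ` {A. S_set G k A})"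

lemma finite_S_sets: "finite (carrier G) \<Longrightarrow> finite {A. S_set G k A}"
  by (rule finite_subset[of _ "Pow (carrier G)"]) (auto simp: S_set_def)

lemma S_set_empty: "S_set G k {}"
  by (auto simp: S_set_def)

lemma max_S_set_attained:
  assumes "finite (carrier G)"
  shows "\<exists>A. S_set G k A \<and> card A = max_S_set k G"
proof -
  have "max_S_set k G \<in> card ` {A. S_set G k A}"
    unfolding max_S_set_def
    using finite_S_sets[OF assms] S_set_empty by (intro Max_in) auto
  then show ?thesis by auto
qed

lemma card_le_max_S_set:
  assumes "finite (carrier G)" "S_set G k A"
  shows "card A \<le> max_S_set k G"
  unfolding max_S_set_def using finite_S_sets[OF assms(1)] assms(2) by (intro Max_ge) auto

end

theory Submission
  imports Defs "HOL-Algebra.Divisibility"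
begin

text \<open>
  Distinct \<open>k\<close>-tuples from an \<open>S\<^sub>k\<close>-set \<open>A\<close> have distinct products, so \<open>(card A) ^ k \<le> n!\<close>. For the
  lower bound let \<open>m = n div k\<close> and let \<open>s\<close> be the \<open>m\<close>-th power of an \<open>n\<close>-cycle, so that the block
  \<open>B = {1, \<dots>, m}\<close> is disjoint from its images under \<open>s, \<dots>, s\<^bsup>k-1\<^esup>\<close>. Then the \<open>m!\<close> permutations
  \<open>s p\<close>, with \<open>p\<close> permuting \<open>B\<close>, form an \<open>S\<^sub>k\<close>-set: the product \<open>(s p\<^sub>1) \<dots> (s p\<^sub>k)\<close> moves the points of
  \<open>s\<^bsup>-(k-1)\<^esup> B\<close> through \<open>k - 1\<close> plain steps of \<open>s\<close> into \<open>B\<close>, where \<open>s p\<^sub>1\<close> acts on them. It therefore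
  determines \<open>p\<^sub>1\<close>, which can be cancelled. Finally \<open>n! \<le> (2 k)\<^sup>n (m!)\<^sup>k\<close>, and an exponential
  factor \<open>c\<^sup>n\<close> is only a power \<open>(n!)\<^bsup>O(1 / ln n)\<^esup>\<close>, because \<open>n\<^sup>n \<le> (n!)\<^sup>2\<close>.
\<close>

lemma S_set_card_power_le_order:
  assumes "monoid G" and fin: "finite (carrier G)" and A: "S_set G k A"
  shows "card A ^ k \<le> order G"
proof -
  interpret monoid G by fact
  let ?tuples = "{as. set as \<subseteq> A \<and> length as = k}"
  let ?product = "\<lambda>as. foldr (\<otimes>\<^bsub>G\<^esub>) as \<one>\<^bsub>G\<^esub>"
  have A_carrier: "A \<subseteq> carrier G"
    using A by (simp add: S_set_def)
  have "card A ^ k = card ?tuples"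
    using card_lists_length_eq[OF finite_subset[OF A_carrier fin]] by simp
  also have "\<dots> \<le> card (carrier G)"
  proof (rule card_inj_on_le)
    show "inj_on ?product ?tuples"
      using A by (auto simp: inj_on_def S_set_def)
    show "?product ` ?tuples \<subseteq> carrier G"
      using A_carrier by (auto intro!: multlist_closed)
  qed (rule fin)
  finally show ?thesis by (simp add: order_def)
qed

lemma power_powr_inverse:
  fixes x :: real
  assumes "0 < k" "0 \<le> x"
  shows "(x ^ k) powr (1 / real k) = x"
  using assms by (simp add: real_root_power_cancel flip: root_powr_inverse)

lemma max_S_set_le_order_powr:
  assumes "monoid G" "finite (carrier G)" "0 < k"
  shows "real (max_S_set k G) \<le> real (order G) powr (1 / real k)"
proof -
  have "max_S_set k G ^ k \<le> order G"
    using max_S_set_attained S_set_card_power_le_order assms by metis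
  then have "real (max_S_set k G) ^ k \<le> real (order G)"
    by (metis of_nat_le_iff of_nat_power)
  then have "(real (max_S_set k G) ^ k) powr (1 / real k) \<le> real (order G) powr (1 / real k)"
    by (intro powr_mono2) auto
  then show ?thesis
    using assms(3) by (simp add: power_powr_inverse)
qed

lemma finite_carrier_sym_group: "finite (carrier (sym_group n))"
  by (simp add: sym_group_def finite_permutations)

definition no_return_before :: "nat \<Rightarrow> ('a \<Rightarrow> 'a) \<Rightarrow> 'a set \<Rightarrow> bool" where
  "no_return_before k s B \<longleftrightarrow> (\<forall>y\<in>B. \<forall>j. 0 < j \<and> j < k \<longrightarrow> (s ^^ j) y \<notin> B)"

lemma funpow_notin_before_hit:
  assumes "no_return_before k s B" "(s ^^ l) z \<in> B" "l < k" "j < l"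
  shows "(s ^^ j) z \<notin> B"
proof
  assume "(s ^^ j) z \<in> B"
  moreover have "(s ^^ (l - j)) ((s ^^ j) z) = (s ^^ l) z"
    using \<open>j < l\<close> by (metis comp_apply funpow_add le_add_diff_inverse2 less_imp_le)
  moreover have "0 < l - j" "l - j < k"
    using assms(3,4) by auto
  ultimately show False
    using assms(1,2) unfolding no_return_before_def by metis
qed

lemma foldr_comp_eq_funpow:
  assumes "\<And>a x. a \<in> set as \<Longrightarrow> x \<notin> B \<Longrightarrow> a x = s x"
    and "\<And>j. j < length as \<Longrightarrow> (s ^^ j) z \<notin> B"
  shows "foldr (\<circ>) as id z = (s ^^ length as) z"
  using assms by (induction as) simp_all

lemma foldr_comp_eq_funpow_if_hit:
  assumes "no_return_before k s B" "length as < k" "(s ^^ length as) z \<in> B"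
    and "\<And>a x. a \<in> set as \<Longrightarrow> x \<notin> B \<Longrightarrow> a x = s x"
  shows "foldr (\<circ>) as id z = (s ^^ length as) z"
  using assms(4)
proof (rule foldr_comp_eq_funpow)
  show "(s ^^ j) z \<notin> B" if "j < length as" for j
    using assms(1,3,2) that by (rule funpow_notin_before_hit)
qed

lemma foldr_comp_inject:
  assumes s: "surj s" "no_return_before k s B"
    and A: "\<And>a. a \<in> A \<Longrightarrow> inj a" "\<And>a x. a \<in> A \<Longrightarrow> x \<notin> B \<Longrightarrow> a x = s x"
    and "length as = length bs" "length as \<le> k" "set as \<subseteq> A" "set bs \<subseteq> A"
    and "foldr (\<circ>) as id = foldr (\<circ>) bs id"
  shows "as = bs"
  using assms(5-)
proof (induction as bs rule: list_induct2)
  case (Cons a as b bs)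
  have products_eq: "a (foldr (\<circ>) as id x) = b (foldr (\<circ>) bs id x)" for x
    using Cons.prems(4) by (metis comp_apply foldr_Cons)
  have "a y = b y" for y
  proof (cases "y \<in> B")
    case True
    obtain z where z: "(s ^^ length as) z = y"
      using surj_fn[OF s(1)] by (metis surjD)
    have "foldr (\<circ>) as id z = y"
      using foldr_comp_eq_funpow_if_hit[OF s(2), of as z] A(2) Cons.prems(1,2) True z by auto
    moreover have "foldr (\<circ>) bs id z = y"
      using foldr_comp_eq_funpow_if_hit[OF s(2), of bs z] A(2) Cons.prems(1,3) Cons.hyps True z
      by auto
    ultimately show ?thesis
      using products_eq[of z] by simp
  next
    case False
    then show ?thesis using A(2)[of a y] A(2)[of b y] Cons.prems(2,3) by simp
  qed
  then have "a = b" by (rule ext)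
  moreover have "foldr (\<circ>) as id = foldr (\<circ>) bs id"
  proof
    fix x
    show "foldr (\<circ>) as id x = foldr (\<circ>) bs id x"
      using products_eq[of x] \<open>a = b\<close> A(1)[of a] Cons.prems(2) by (simp add: inj_eq)
  qed
  then have "as = bs"
    using Cons.prems(1-3) by (intro Cons.IH) (assumption | simp)+
  ultimately show ?case by simp
qed simp

lemma S_set_shifted_permutations:
  assumes s: "s permutes {1..n}" and B: "B \<subseteq> {1..n}" and no_return: "no_return_before k s B"
  shows "S_set (sym_group n) k ((\<circ>) s ` {p. p permutes B})" (is "S_set _ _ ?A")
  unfolding S_set_def
proof (intro conjI allI impI)
  show "?A \<subseteq> carrier (sym_group n)"
    using permutes_compose[OF permutes_subset[OF _ B] s] by (auto simp: sym_group_carrier)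
next
  fix as bs
  assume tuples: "length as = k \<and> length bs = k \<and> set as \<subseteq> ?A \<and> set bs \<subseteq> ?A \<and>
    foldr (\<otimes>\<^bsub>sym_group n\<^esub>) as \<one>\<^bsub>sym_group n\<^esub> = foldr (\<otimes>\<^bsub>sym_group n\<^esub>) bs \<one>\<^bsub>sym_group n\<^esub>"
  have "inj a" if "a \<in> ?A" for a
    using that s by (auto intro: inj_compose permutes_inj)
  moreover have "a x = s x" if "a \<in> ?A" "x \<notin> B" for a x
    using that by (auto simp: permutes_not_in)
  ultimately show "as = bs"
    using tuples permutes_surj[OF s] no_return
    by (intro foldr_comp_inject[where A = ?A]) (auto simp: sym_group_mult sym_group_one)
qed

lemma fact_card_le_max_S_set:
  assumes "s permutes {1..n}" "B \<subseteq> {1..n}" "no_return_before k s B"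
  shows "fact (card B) \<le> max_S_set k (sym_group n)"
proof -
  let ?A = "(\<circ>) s ` {p. p permutes B}"
  have "inj_on ((\<circ>) s) {p. p permutes B}"
    using fun.inj_map[OF permutes_inj[OF assms(1)]] by (rule inj_on_subset) simp
  then have "card ?A = fact (card B)"
    using finite_subset[OF assms(2)] by (simp add: card_image card_permutations)
  then show ?thesis
    using card_le_max_S_set[OF finite_carrier_sym_group S_set_shifted_permutations[OF assms]]
    by simp
qed

lemma funpow_cycle_of_list_nth:
  assumes "distinct cs" "i < length cs"
  shows "(cycle_of_list cs ^^ j) (cs ! i) = cs ! ((j + i) mod length cs)"
  using arg_cong[OF cyclic_rotation[OF assms(1), of j], of "\<lambda>xs. xs ! i"] assms(2)
  by (simp add: nth_rotate)

lemma no_return_before_cycle_power: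
  assumes "k * m \<le> n"
  shows "no_return_before k (cycle_of_list [1..<Suc n] ^^ m) {1..m}"
  unfolding no_return_before_def
proof (intro ballI allI impI)
  fix y j
  assume y: "y \<in> {1..m}" and j: "0 < j \<and> j < k"
  have "Suc j * m \<le> k * m"
    using j by (intro mult_right_mono) auto
  then have "m * j + y \<le> n"
    using y assms by (simp add: mult.commute)
  moreover from this have "y - 1 < n"
    using y by auto
  ultimately have "(cycle_of_list [1..<Suc n] ^^ (m * j)) y = m * j + y"
    using funpow_cycle_of_list_nth[of "[1..<Suc n]" "y - 1" "m * j"] y by (simp del: upt_Suc)
  moreover have "m \<le> m * j"
    using j by simp
  ultimately have "m < (cycle_of_list [1..<Suc n] ^^ (m * j)) y"
    using y unfolding atLeastAtMost_iff by linarith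
  then show "((cycle_of_list [1..<Suc n] ^^ m) ^^ j) y \<notin> {1..m}"
    by (simp add: funpow_mult del: upt_Suc)
qed

lemma fact_div_le_max_S_set: "fact (n div k) \<le> max_S_set k (sym_group n)"
proof -
  let ?c = "cycle_of_list [1..<Suc n]"
  have "?c permutes {1..n}"
    using cycle_permutes[of "[1..<Suc n]"]
    by (simp add: atLeastLessThanSuc_atLeastAtMost del: upt_Suc)
  then have "?c ^^ (n div k) permutes {1..n}"
    by (rule permutes_funpow)
  moreover have "no_return_before k (?c ^^ (n div k)) {1..n div k}"
    by (rule no_return_before_cycle_power) simp
  ultimately have "fact (card {1..n div k}) \<le> max_S_set k (sym_group n)"
    by (intro fact_card_le_max_S_set) auto
  then show ?thesis by simp
qed

lemma fact_le_power_mult_fact_div_mod: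
  assumes "0 < k"
  shows "fact n \<le> k ^ n * fact (n div k) ^ k * Suc (n div k) ^ (n mod k)"
proof (induction n)
  case (Suc n)
  define m r where "m = n div k" and "r = n mod k"
  have "Suc n = k * m + Suc r"
    by (simp add: m_def r_def)
  also have "\<dots> \<le> k * Suc m"
    using mod_less_divisor[OF assms, of n] by (simp add: r_def)
  finally have "fact (Suc n) \<le> k * Suc m * (k ^ n * fact m ^ k * Suc m ^ r)"
    unfolding fact_Suc using Suc.IH by (intro mult_mono) (simp_all add: m_def r_def)
  also have "\<dots> = k ^ Suc n * fact m ^ k * Suc m ^ Suc r"
    by (simp add: algebra_simps)
  also have "\<dots> = k ^ Suc n * fact (Suc n div k) ^ k * Suc (Suc n div k) ^ (Suc n mod k)"
  proof (cases "Suc r = k")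
    case True
    then have "Suc n div k = Suc m" "Suc n mod k = 0"
      by (simp_all add: div_Suc mod_Suc m_def r_def)
    moreover have "fact (Suc m) ^ k = Suc m ^ k * fact m ^ k"
      by (simp only: fact_Suc of_nat_id power_mult_distrib)
    ultimately show ?thesis
      using True by (simp del: power_Suc fact_Suc)
  next
    case False
    then have "Suc n div k = m" "Suc n mod k = Suc r"
      by (simp_all add: div_Suc mod_Suc m_def r_def)
    then show ?thesis by simp
  qed
  finally show ?case .
qed simp

lemma fact_le_power_mult_fact_div:
  assumes "0 < k"
  shows "fact n \<le> (2 * k) ^ n * fact (n div k) ^ k"
proof -
  let ?m = "n div k"
  have "Suc ?m ^ (n mod k) \<le> (2 ^ ?m) ^ (n mod k)"
    by (intro power_mono Suc_leI less_exp) simp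
  also have "\<dots> \<le> (2 ^ ?m) ^ k"
    using assms by (intro power_increasing) auto
  also have "\<dots> \<le> 2 ^ n"
    by (simp flip: power_mult)
  finally have Suc_power_le: "Suc ?m ^ (n mod k) \<le> 2 ^ n" .
  have "fact n \<le> k ^ n * fact ?m ^ k * Suc ?m ^ (n mod k)"
    using assms by (rule fact_le_power_mult_fact_div_mod)
  also have "\<dots> \<le> k ^ n * fact ?m ^ k * 2 ^ n"
    using Suc_power_le by (rule mult_left_mono) simp
  also have "\<dots> = (2 * k) ^ n * fact ?m ^ k"
    by (simp add: power_mult_distrib)
  finally show ?thesis .
qed

lemma power_self_le_fact_square: "n ^ n \<le> (fact n)\<^sup>2" for n :: nat
proof -
  have "n ^ n = (\<Prod>i=1..n. n)" by simp
  also have "\<dots> \<le> (\<Prod>i=1..n. i * (n + 1 - i))"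
  proof (rule prod_mono)
    fix i assume i: "i \<in> {1..n}"
    then obtain j where n: "n = i + j"
      using le_Suc_ex by auto
    have "1 * j \<le> i * j"
      using i by (intro mult_right_mono) auto
    then show "0 \<le> n \<and> n \<le> i * (n + 1 - i)"
      using n by simp
  qed
  also have "\<dots> = (\<Prod>i=1..n. i) * (\<Prod>i=1..n. n + 1 - i)"
    by (rule prod.distrib)
  also have "(\<Prod>i=1..n. n + 1 - i) = (\<Prod>i=1..n. i)"
    by (subst prod.atLeastAtMost_rev) simp
  finally show ?thesis by (simp add: fact_prod power2_eq_square)
qed

lemma power_le_fact_powr_log:
  fixes c :: real
  assumes "1 \<le> c" "2 \<le> n"
  shows "c ^ n \<le> fact n powr (2 * log n c)"
proof -
  have "c ^ n = (real n powr log n c) ^ n"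
    using assms by simp
  also have "\<dots> = (real n ^ n) powr log n c"
    using assms by (simp add: powr_powr mult.commute del: powr_log_cancel flip: powr_realpow)
  also have "\<dots> \<le> ((fact n)\<^sup>2) powr log n c"
  proof (rule powr_mono2)
    have "real (n ^ n) \<le> real ((fact n)\<^sup>2)"
      using power_self_le_fact_square by (rule of_nat_mono)
    then show "real n ^ n \<le> (fact n)\<^sup>2" by simp
  qed (use assms in auto)
  also have "\<dots> = fact n powr (2 * log n c)"
    by (simp add: powr_powr flip: powr_numeral)
  finally show ?thesis .
qed

lemma fact_powr_le_fact_div:
  assumes "0 < k" "2 \<le> n"
  shows "fact n powr ((1 - 2 * log n (2 * k)) / k) \<le> (fact (n div k) :: real)"
proof -
  let ?e = "2 * log n (2 * k)"
  have "real (fact n) \<le> real ((2 * k) ^ n * fact (n div k) ^ k)"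
    using fact_le_power_mult_fact_div[OF assms(1)] by (rule of_nat_mono)
  also have "\<dots> = real (2 * k) ^ n * fact (n div k) ^ k"
    by simp
  also have "\<dots> \<le> fact n powr ?e * fact (n div k) ^ k"
    using power_le_fact_powr_log[of "real (2 * k)" n] assms by (intro mult_right_mono) auto
  finally have "fact n powr (1 - ?e) \<le> fact (n div k) ^ k"
    by (simp add: powr_diff divide_le_eq mult.commute)
  then have "(fact n powr (1 - ?e)) powr (1 / k) \<le> (fact (n div k) ^ k) powr (1 / k)"
    by (intro powr_mono2) auto
  then show ?thesis
    using assms(1) by (simp add: power_powr_inverse powr_powr)
qed

theorem theorem1p7:
  fixes k :: nat
  assumes "k \<ge> 1"
  shows "\<exists>C::real. C > 0 \<and> (\<forall>n::nat. n \<ge> 2 \<longrightarrow>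
    (fact n :: real) powr (1 / real k - C / ln (real n)) \<le> real (max_S_set k (sym_group n)) \<and>
    real (max_S_set k (sym_group n)) \<le> (fact n :: real) powr (1 / real k + C / ln (real n)))"
proof (intro exI[of _ "2 * ln (2 * real k) / real k"] conjI allI impI)
  let ?C = "2 * ln (2 * real k) / real k"
  show "0 < ?C"
    using assms by simp
  fix n :: nat
  assume n: "2 \<le> n"
  let ?M = "max_S_set k (sym_group n)"
  have "fact n powr (1 / real k - ?C / ln (real n)) = fact n powr ((1 - 2 * log n (2 * k)) / k)"
    by (simp add: log_def diff_divide_distrib mult.commute)
  also have "\<dots> \<le> real (fact (n div k))"
    using fact_powr_le_fact_div[of k n] assms n by simp
  also have "\<dots> \<le> real ?M"
    using fact_div_le_max_S_set by (rule of_nat_mono)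
  finally show "fact n powr (1 / real k - ?C / ln (real n)) \<le> real ?M" .
  have "real ?M \<le> fact n powr (1 / real k)"
    using max_S_set_le_order_powr[OF group.is_monoid[OF sym_group_is_group]
        finite_carrier_sym_group, of k n] assms
    by (simp add: order_def sym_group_card_carrier)
  also have "\<dots> \<le> fact n powr (1 / real k + ?C / ln (real n))"
    using assms n by (intro powr_mono) (simp_all add: divide_nonneg_pos)
  finally show "real ?M \<le> fact n powr (1 / real k + ?C / ln (real n))" .
qed

end
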